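(* In the setting of the context, let $\varphi:TW\to W\times\mathbb{C}^N$ be the bundle map $\varphi(X)=\sum_{j=1}^N\tilde\Omega_{Nj}(X)\,\mathbf{e}_j$. Then $\varphi$ is an isomorphism at every point of $W$ if and only if $P_{N,i_{k,0}}\neq 0$ for all $k=1,\dots,n$ at every point of $W$, where $i_{k,0}:=m_1+\dots+m_{k-1}+1$ (the index of the first row/column of the $k$-th block).
   Context: Let $N\ge1$, $W\subset\mathbb{C}^N$ open, and $T,\tilde\Omega,B_\infty=\mathrm{diag}(\lambda_1,\dots,\lambda_N)$ define an extended generalized Okubo system on $\mathbb{P}^1\times W$: $T$ is an $N\times N$ matrix of holomorphic functions, $\tilde\Omega$ an $N\times N$ matrix of holomorphic $1$-forms, $\lambda_i-\lambda_j\notin\mathbb{Z}\setminus\{0\}$ for $i\ne j$, and $[T,\tilde\Omega]=0$, $\tilde\Omega\wedge\tilde\Omega=0$, $dT+\tilde\Omega+[\tilde\Omega,B_\infty]=0$, $d\tilde\Omega=0$. Assume there is an invertible holomorphic matrix $P$ on $W$ with $P^{-1}TP=Z_1\oplus\cdots\oplus Z_n$ and $P^{-1}\tilde\Omega P=-(dZ_1\oplus\cdots\oplus dZ_n)$, where $m_1+\dots+m_n=N$, $\Lambda_k$ is the $m_k\times m_k$ matrix with $1$'s on the superdiagonal and zeros elsewhere, $Z_k=\sum_{l=0}^{m_k-1}z_{k,l}\Lambda_k^l$, the $z_{k,0}$ are pairwise distinct on $W$, and the holomorphic functions $(z_{k,l})_{k,l}$ form a coordinate system on $W$. $\mathbf{e}_1,\dots,\mathbf{e}_N$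 is the standard basis of $\mathbb{C}^N$. *)

theory Defs
  imports "HOL-Analysis.Analysis" "Jordan_Normal_Form.Jordan_Normal_Form"
begin

text \<open>Points of the open set W are vectors in complex^'N, with N = CARD('N).
  Matrices are Jordan_Normal_Form matrices (indices 0-based).
  A matrix of holomorphic 1-forms Omega is represented by its coefficient matrices
  Om a (a :: 'N), i.e. Omega = sum_a Om a dt_a.\<close>

text \<open>Holomorphic (complex differentiable) scalar function on an open set of complex^'N:
  Frechet differentiable with complex-linear derivative.\<close>

definition holomorphic_on_cn :: "(complex^'N \<Rightarrow> complex) \<Rightarrow> (complex^'N) set \<Rightarrow> bool" where
  "holomorphic_on_cn f W \<longleftrightarrow>
     (\<forall>x\<in>W. \<exists>L. (f has_derivative L) (at x) \<and> (\<forall>c v. L (vector_scalar_mult c v) = c * L v))"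

text \<open>Complex partial derivative in the direction of the a-th coordinate.\<close>
definition cpartial :: "(complex^'N \<Rightarrow> complex) \<Rightarrow> 'N \<Rightarrow> complex^'N \<Rightarrow> complex" where
  "cpartial f a x = deriv (\<lambda>t::complex. f (x + vector_scalar_mult t (axis a 1))) 0"

definition holomorphic_mat_on :: "nat \<Rightarrow> (complex^'N \<Rightarrow> complex mat) \<Rightarrow> (complex^'N) set \<Rightarrow> bool" where
  "holomorphic_mat_on N A W \<longleftrightarrow> (\<forall>x\<in>W. A x \<in> carrier_mat N N) \<and>
     (\<forall>i<N. \<forall>j<N. holomorphic_on_cn (\<lambda>x. A x $$ (i,j)) W)"

text \<open>Entrywise partial derivative of an N x N matrix valued function.\<close>
definition cpartial_mat :: "nat \<Rightarrow> (complex^'N \<Rightarrow> complex mat) \<Rightarrow> 'N \<Rightarrow> complex^'N \<Rightarrow> complex mat" where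
  "cpartial_mat N A a x = mat N N (\<lambda>(i,j). cpartial (\<lambda>y. A y $$ (i,j)) a x)"

text \<open>Lambda_k: m x m matrix with 1's on the superdiagonal, zeros elsewhere.\<close>
definition Lam :: "nat \<Rightarrow> complex mat" where
  "Lam m = jordan_block m 0"

text \<open>Z_k = sum_{l<m_k} z_{k,l} Lambda_k^l.\<close>
definition Zblock :: "(nat \<Rightarrow> nat) \<Rightarrow> (nat \<Rightarrow> nat \<Rightarrow> complex^'N \<Rightarrow> complex) \<Rightarrow> nat \<Rightarrow> complex^'N \<Rightarrow> complex mat" where
  "Zblock m z k x = foldr (\<lambda>l acc. z k l x \<cdot>\<^sub>m (Lam (m k) ^\<^sub>m l) + acc) [0..<m k] (0\<^sub>m (m k) (m k))"

text \<open>Coefficient of dt_a in dZ_k = sum_{l<m_k} dz_{k,l} Lambda_k^l.\<close>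
definition dZblock :: "(nat \<Rightarrow> nat) \<Rightarrow> (nat \<Rightarrow> nat \<Rightarrow> complex^'N \<Rightarrow> complex) \<Rightarrow> nat \<Rightarrow> 'N \<Rightarrow> complex^'N \<Rightarrow> complex mat" where
  "dZblock m z k a x = foldr (\<lambda>l acc. cpartial (z k l) a x \<cdot>\<^sub>m (Lam (m k) ^\<^sub>m l) + acc) [0..<m k] (0\<^sub>m (m k) (m k))"

text \<open>Extended generalized Okubo system (T, Omega, B_infinity = diag lam) on W.\<close>
definition ext_gen_okubo ::
  "nat \<Rightarrow> (complex^'N) set \<Rightarrow> (complex^'N \<Rightarrow> complex mat) \<Rightarrow> ('N \<Rightarrow> complex^'N \<Rightarrow> complex mat)
     \<Rightarrow> (nat \<Rightarrow> complex) \<Rightarrow> bool" where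
  "ext_gen_okubo N W T Om lam \<longleftrightarrow>
     (let B = mat N N (\<lambda>(i,j). if i = j then lam i else 0) in
      holomorphic_mat_on N T W \<and> (\<forall>a. holomorphic_mat_on N (Om a) W) \<and>
      (\<forall>i<N. \<forall>j<N. i \<noteq> j \<longrightarrow> (\<forall>k::int. lam i - lam j = of_int k \<longrightarrow> k = 0)) \<and>
      \<comment> \<open>[T, Omega] = 0\<close>
      (\<forall>x\<in>W. \<forall>a. T x * Om a x = Om a x * T x) \<and>
      \<comment> \<open>Omega wedge Omega = 0\<close>
      (\<forall>x\<in>W. \<forall>a b. Om a x * Om b x - Om b x * Om a x = 0\<^sub>m N N) \<and>
      \<comment> \<open>dT + Omega + [Omega, B] = 0\<close>
      (\<forall>x\<in>W. \<forall>a. cpartial_mat N T a x + Om a x + (Om a x * B - B * Om a x) = 0\<^sub>m N N) \<and>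
      \<comment> \<open>d Omega = 0\<close>
      (\<forall>x\<in>W. \<forall>a b. cpartial_mat N (Om b) a x - cpartial_mat N (Om a) b x = 0\<^sub>m N N))"

text \<open>The bundle map phi at x: X = v (tangent vector in C^N) maps to
  sum_j Omega_{N,j}(X) e_j, i.e. (0-based) row N-1 of Omega(v).\<close>
definition phi_map :: "nat \<Rightarrow> ('N \<Rightarrow> complex^'N \<Rightarrow> complex mat) \<Rightarrow> complex^'N \<Rightarrow> complex^'N \<Rightarrow> complex vec" where
  "phi_map N Om x v = vec N (\<lambda>j. \<Sum>a\<in>UNIV. vec_nth v a * (Om a x $$ (N - 1, j)))"

text \<open>0-based index of the first row/column of the k-th block (k 0-based).\<close>
definition istart :: "(nat \<Rightarrow> nat) \<Rightarrow> nat \<Rightarrow> nat" where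
  "istart m k = (\<Sum>k'<k. m k')"

end

theory Submission imports Defs begin

text \<open>
  Let p be the last row of P and D(v) the block diagonal matrix with blocks dZ_k(v), so that
  Omega(v) P = - P D(v). Then P^T phi(v) = - p D(v). Each dZ_k(v) is an upper triangular Toeplitz
  matrix in the differentials dz_{k,l}(v); hence - p D(v) is the image of the vector of all
  dz_{k,l}(v) under a lower triangular matrix whose diagonal entries are the - p_{i_k,0}, each
  repeated m_k times. As the z_{k,l} are coordinates, v \<mapsto> (dz_{k,l}(v)) is invertible, so phi is
  an isomorphism iff all p_{i_k,0} are nonzero.
\<close>

lemma istart_Suc: "istart m (Suc k) = istart m k + m k"
  by (simp add: istart_def)

lemma istart_mono: "k \<le> k' \<Longrightarrow> istart m k \<le> istart m k'"
  unfolding istart_def by (rule sum_mono2) auto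

lemma istart_add_less: "k < n \<Longrightarrow> s < m k \<Longrightarrow> istart m k + s < (\<Sum>k<n. m k)"
  using istart_mono[of "Suc k" n m] by (simp add: istart_Suc istart_def[of m n, symmetric])

lemma sum_list_map_upt_istart: "sum_list (map m [0..<k]) = istart m k"
  unfolding istart_def by (simp add: sum_list_sum_nth atLeast0LessThan)

lemma sum_lessThan_add_split:
  "(\<Sum>i<a + (b::nat). f i) = (\<Sum>i<a. f i) + (\<Sum>s<b. (f (a + s) :: 'a::comm_monoid_add))"
  by (induction b) (simp_all add: add.assoc)

lemma sum_lessThan_blocks:
  "(\<Sum>i<(\<Sum>k<n. m k). f i) = (\<Sum>k<n. \<Sum>s<m k. (f (istart m k + s) :: 'a::comm_monoid_add))"
proof (induction n)
  case (Suc n)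
  have "(\<Sum>i<(\<Sum>k<Suc n. m k). f i) = (\<Sum>i<(\<Sum>k<n. m k). f i) + (\<Sum>s<m n. f ((\<Sum>k<n. m k) + s))"
    using sum_lessThan_add_split by simp
  then show ?case using Suc.IH by (simp add: istart_def)
qed simp

lemma block_decomposition_exists:
  "i < (\<Sum>k<n. m k) \<Longrightarrow> \<exists>k<n. \<exists>s<m k. i = istart m k + s"
proof (induction n)
  case (Suc n)
  show ?case
  proof (cases "i < (\<Sum>k<n. m k)")
    case True
    then show ?thesis using Suc.IH by (meson less_SucI)
  next
    case False
    then show ?thesis using Suc.prems
      by (intro exI[of _ n]) (auto simp: istart_def intro!: exI[of _ "i - (\<Sum>k<n. m k)"])
  qed
qed simp

lemma block_decomposition_unique:
  assumes "s < m k" "s' < m k'" "istart m k + s = istart m k' + s'"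
  shows "k = k'" "s = s'"
proof -
  have "\<not> k < k'" if "s < m k" "istart m k + s = istart m k' + s'" for k k' s s'
  proof
    assume "k < k'"
    then have "istart m (Suc k) \<le> istart m k'" by (intro istart_mono) simp
    with that show False by (simp add: istart_Suc)
  qed
  with assms show "k = k'" by (metis linorder_neqE_nat)
  with assms show "s = s'" by simp
qed

definition block_pos :: "nat \<Rightarrow> (nat \<Rightarrow> nat) \<Rightarrow> nat \<Rightarrow> nat \<times> nat" where
  "block_pos n m i = (SOME (k, s). k < n \<and> s < m k \<and> i = istart m k + s)"

lemma block_pos_bounds:
  assumes "i < (\<Sum>k<n. m k)" and "block_pos n m i = (k, s)"
  shows "k < n" "s < m k" "i = istart m k + s"
proof -
  obtain k0 s0 where "k0 < n" "s0 < m k0" "i = istart m k0 + s0"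
    using block_decomposition_exists[OF assms(1)] by blast
  then have "\<exists>p. case p of (k, s) \<Rightarrow> k < n \<and> s < m k \<and> i = istart m k + s"
    by (intro exI[of _ "(k0, s0)"]) simp
  from someI_ex[OF this] assms(2) show "k < n" "s < m k" "i = istart m k + s"
    unfolding block_pos_def by auto
qed

lemma block_pos_istart:
  assumes "k < n" "s < m k"
  shows "block_pos n m (istart m k + s) = (k, s)"
proof -
  obtain k' s' where pos: "block_pos n m (istart m k + s) = (k', s')" by fastforce
  note b = block_pos_bounds[OF istart_add_less[of k n s m, OF assms] pos]
  show ?thesis
    using pos block_decomposition_unique[OF b(2) assms(2) b(3)[symmetric]] by simp
qed

lemma sum_list_take_dim_row_less:
  assumes "k < length As" "s < dim_row (As ! k)"
  shows "sum_list (map dim_row (take k As)) + s < sum_list (map dim_row As)"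
  using assms by (induction As arbitrary: k) (auto simp: less_Suc_eq_0_disj)

lemma diag_block_mat_index:
  assumes "\<forall>A\<in>set As. dim_col A = dim_row A" "k < length As" "k' < length As"
    "s < dim_row (As ! k)" "s' < dim_row (As ! k')"
  shows "diag_block_mat As $$ (sum_list (map dim_row (take k As)) + s,
                              sum_list (map dim_row (take k' As)) + s')
     = (if k = k' then As ! k $$ (s, s') else 0)"
  using assms
proof (induction As arbitrary: k k')
  case (Cons A As)
  have dims: "sum_list (map dim_col As) = sum_list (map dim_row As)" "dim_col A = dim_row A"
    using Cons.prems(1) by (simp_all cong: map_cong)
  have tail: "sum_list (map dim_row (take j As)) + t < sum_list (map dim_row As)"
    if "j < length As" "t < dim_row (As ! j)" for j t
    using that by (rule sum_list_take_dim_row_less)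
  show ?case
    using Cons.prems
    by (cases k; cases k') (simp_all add: Let_def dim_diag_block_mat add.assoc dims tail Cons.IH)
qed simp

lemma foldr_smult_add_carrier:
  assumes "\<And>l. L l \<in> carrier_mat d d"
  shows "foldr (\<lambda>l acc. g l \<cdot>\<^sub>m L l + acc) xs (0\<^sub>m d d) \<in> carrier_mat d d"
  using assms by (induction xs) auto

lemma foldr_smult_add_index:
  assumes "\<And>l. L l \<in> carrier_mat d d" "s < d" "s' < d"
  shows "foldr (\<lambda>l acc. g l \<cdot>\<^sub>m L l + acc) xs (0\<^sub>m d d) $$ (s, s') = (\<Sum>l\<leftarrow>xs. g l * L l $$ (s, s'))"
proof (induction xs)
  case (Cons l xs)
  have "foldr (\<lambda>l acc. g l \<cdot>\<^sub>m L l + acc) xs (0\<^sub>m d d) \<in> carrier_mat d d" "L l \<in> carrier_mat d d"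
    using assms foldr_smult_add_carrier[of L d g xs] by blast+
  with Cons assms(2,3) show ?case by simp
qed (use assms in simp)

lemma dZblock_carrier: "dZblock m z k a x \<in> carrier_mat (m k) (m k)"
  unfolding dZblock_def Lam_def by (rule foldr_smult_add_carrier) simp

lemma dZblock_dims [simp]:
  "dim_row (dZblock m z k a x) = m k" "dim_col (dZblock m z k a x) = m k"
  using dZblock_carrier[of m z k a x] by auto

lemma dZblock_index:
  assumes "s < m k" "s' < m k"
  shows "dZblock m z k a x $$ (s, s') = (if s \<le> s' then cpartial (z k (s' - s)) a x else 0)"
proof -
  have Lam_pow: "(Lam (m k) ^\<^sub>m l) $$ (s, s') = (if l = s' - s \<and> s \<le> s' then 1 else 0)" for l
    unfolding Lam_def jordan_block_pow using assms by (cases "l < s' - s") auto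
  have "dZblock m z k a x $$ (s, s') = (\<Sum>l\<leftarrow>[0..<m k]. cpartial (z k l) a x * (Lam (m k) ^\<^sub>m l) $$ (s, s'))"
    unfolding dZblock_def Lam_def using assms by (intro foldr_smult_add_index) auto
  also have "\<dots> = (\<Sum>l<m k. if l = s' - s \<and> s \<le> s' then cpartial (z k l) a x else 0)"
    by (simp add: sum_list_sum_nth atLeast0LessThan Lam_pow if_distrib cong: if_cong)
  also have "\<dots> = (if s \<le> s' then cpartial (z k (s' - s)) a x else 0)"
    using assms by (auto simp: sum.delta')
  finally show ?thesis .
qed

lemma sum_dim_row_take_dZblocks:
  "j \<le> n \<Longrightarrow> sum_list (map dim_row (take j (map (\<lambda>k. dZblock m z k a x) [0..<n]))) = istart m j"
proof -
  assume "j \<le> n"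
  then have "map dim_row (take j (map (\<lambda>k. dZblock m z k a x) [0..<n])) = map m [0..<j]"
    by (simp add: take_map take_upt)
  then show ?thesis by (simp only: sum_list_map_upt_istart)
qed

lemma diag_block_dZblock_carrier:
  "diag_block_mat (map (\<lambda>k. dZblock m z k a x) [0..<n]) \<in> carrier_mat (\<Sum>k<n. m k) (\<Sum>k<n. m k)"
proof -
  let ?As = "map (\<lambda>k. dZblock m z k a x) [0..<n]"
  have rows: "sum_list (map dim_row ?As) = (\<Sum>k<n. m k)"
    using sum_dim_row_take_dZblocks[of n n m z a x] by (simp add: istart_def)
  have "map dim_col ?As = map dim_row ?As" by simp
  with rows show ?thesis by (intro carrier_matI) (simp_all only: dim_diag_block_mat)
qed

lemma diag_block_dZblock_index:
  assumes "k < n" "k' < n" "s < m k" "s' < m k'"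
  shows "diag_block_mat (map (\<lambda>k. dZblock m z k a x) [0..<n]) $$ (istart m k + s, istart m k' + s')
     = (if k = k' \<and> s \<le> s' then cpartial (z k (s' - s)) a x else 0)"
  using diag_block_mat_index[of "map (\<lambda>k. dZblock m z k a x) [0..<n]" k k' s s'] assms
  by (cases "k = k'") (simp_all add: sum_dim_row_take_dZblocks dZblock_index)

lemma invertible_mat_det_nonzero:
  assumes "invertible_mat (A :: 'a::comm_ring_1 mat)"
  shows "det A \<noteq> 0"
proof -
  obtain B where AB: "A * B = 1\<^sub>m (dim_row A)" and BA: "B * A = 1\<^sub>m (dim_row B)"
    and sq: "dim_col A = dim_row A"
    using assms unfolding invertible_mat_def inverts_mat_def by auto
  have "dim_col B = dim_row A" using arg_cong[OF AB, of dim_col] by simp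
  moreover have "dim_row B = dim_row A" using arg_cong[OF BA, of dim_col] sq by simp
  ultimately have "det (A * B) = det A * det B"
    using sq by (intro det_mult[of _ "dim_row A"]) (auto intro: carrier_matI)
  then have "det A * det B = 1" using AB by simp
  then show ?thesis by auto
qed

lemma bij_mult_mat_vec_iff_det:
  assumes A: "(A :: 'a::field mat) \<in> carrier_mat n n"
  shows "bij_betw ((*\<^sub>v) A) (carrier_vec n) (carrier_vec n) \<longleftrightarrow> det A \<noteq> 0"
proof
  assume bij: "bij_betw ((*\<^sub>v) A) (carrier_vec n) (carrier_vec n)"
  show "det A \<noteq> 0"
  proof
    assume "det A = 0"
    then obtain v where v: "v \<in> carrier_vec n" "v \<noteq> 0\<^sub>v n" "A *\<^sub>v v = 0\<^sub>v n"
      using det_0_iff_vec_prod_zero[OF A] by auto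
    moreover have "A *\<^sub>v 0\<^sub>v n = 0\<^sub>v n" using A by (intro eq_vecI) auto
    ultimately show False
      using bij_betw_imp_inj_on[OF bij] zero_carrier_vec[of n] by (metis inj_onD)
  qed
next
  assume "det A \<noteq> 0"
  then obtain B where B: "B \<in> carrier_mat n n" "A * B = 1\<^sub>m n" "B * A = 1\<^sub>m n"
    using det_non_zero_imp_unit[OF A, of "()"] unfolding Units_def ring_mat_def by auto
  show "bij_betw ((*\<^sub>v) A) (carrier_vec n) (carrier_vec n)"
  proof (rule bij_betwI[where g = "(*\<^sub>v) B"])
    show "B *\<^sub>v (A *\<^sub>v v) = v" if "v \<in> carrier_vec n" for v
      using that A B by (simp flip: assoc_mult_mat_vec)
    show "A *\<^sub>v (B *\<^sub>v v) = v" if "v \<in> carrier_vec n" for v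
      using that A B by (simp flip: assoc_mult_mat_vec)
  qed (use A B in auto)
qed

lemma bij_betw_vec_reindex:
  assumes h: "bij_betw h {..<n} (UNIV :: 'n::finite set)"
  shows "bij_betw (\<lambda>v :: 'a^'n. vec n (\<lambda>t. vec_nth v (h t))) UNIV (carrier_vec n)"
proof (rule bij_betwI')
  show "(vec n (\<lambda>t. vec_nth v (h t)) = vec n (\<lambda>t. vec_nth w (h t))) = (v = w)" for v w :: "'a^'n"
  proof
    assume eq: "vec n (\<lambda>t. vec_nth v (h t)) = vec n (\<lambda>t. vec_nth w (h t))"
    show "v = w"
    proof (rule Finite_Cartesian_Product.vec_eq_iff[THEN iffD2], rule allI)
      fix a
      obtain t where "t < n" "h t = a" using h by (metis UNIV_I bij_betw_def imageE lessThan_iff)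
      then show "vec_nth v a = vec_nth w a" using arg_cong[OF eq, of "\<lambda>u. u $ t"] by simp
    qed
  qed simp
  show "\<exists>v\<in>UNIV. w = vec n (\<lambda>t. vec_nth v (h t))" if "w \<in> carrier_vec n" for w
  proof
    let ?v = "\<chi> a. w $ the_inv_into {..<n} h a"
    have "vec_nth ?v (h t) = w $ t" if "t < n" for t
      using that h by (simp add: bij_betw_def the_inv_into_f_f)
    then show "w = vec n (\<lambda>t. vec_nth ?v (h t))"
      using \<open>w \<in> carrier_vec n\<close> by (intro eq_vecI) auto
  qed simp
qed simp

definition block_toeplitz_mat :: "nat \<Rightarrow> (nat \<Rightarrow> nat) \<Rightarrow> (nat \<Rightarrow> 'a::zero) \<Rightarrow> 'a mat" where
  "block_toeplitz_mat n m q = mat (\<Sum>k<n. m k) (\<Sum>k<n. m k) (\<lambda>(i, j).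
     case (block_pos n m i, block_pos n m j) of ((k, s), (k', s')) \<Rightarrow>
       if k = k' \<and> s' \<le> s then q (istart m k + (s - s')) else 0)"

definition block_vec :: "nat \<Rightarrow> (nat \<Rightarrow> nat) \<Rightarrow> (nat \<Rightarrow> nat \<Rightarrow> 'a) \<Rightarrow> 'a vec" where
  "block_vec n m c = vec (\<Sum>k<n. m k) (\<lambda>i. case_prod c (block_pos n m i))"

lemma block_toeplitz_mat_carrier:
  "block_toeplitz_mat n m q \<in> carrier_mat (\<Sum>k<n. m k) (\<Sum>k<n. m k)"
  by (simp add: block_toeplitz_mat_def)

lemma block_toeplitz_mat_index:
  assumes "k < n" "k' < n" "s < m k" "s' < m k'"
  shows "block_toeplitz_mat n m q $$ (istart m k + s, istart m k' + s')
     = (if k = k' \<and> s' \<le> s then q (istart m k + (s - s')) else 0)"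
  using assms istart_add_less[of k n s m] istart_add_less[of k' n s' m]
  by (simp add: block_toeplitz_mat_def block_pos_istart)

lemma block_vec_index: "k < n \<Longrightarrow> s < m k \<Longrightarrow> block_vec n m c $ (istart m k + s) = c k s"
  using istart_add_less[of k n s m] by (simp add: block_vec_def block_pos_istart)

lemma det_block_toeplitz_mat_nonzero_iff:
  fixes q :: "nat \<Rightarrow> 'a::idom"
  assumes "\<forall>k<n. 0 < m k"
  shows "det (block_toeplitz_mat n m q) \<noteq> 0 \<longleftrightarrow> (\<forall>k<n. q (istart m k) \<noteq> 0)"
proof -
  let ?N = "\<Sum>k<n. m k" and ?T = "block_toeplitz_mat n m q"
  have pos: "\<exists>k s. k < n \<and> s < m k \<and> i = istart m k + s" if "i < ?N" for i
    using block_decomposition_exists[OF that] by blast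
  have "det ?T = prod_list (diag_mat ?T)"
  proof (rule det_lower_triangular[OF _ block_toeplitz_mat_carrier])
    show "?T $$ (i, j) = 0" if "i < j" "j < ?N" for i j
      using pos[of i] pos[of j] that by (auto simp: block_toeplitz_mat_index)
  qed
  also have "\<dots> = (\<Prod>i = 0..<?N. ?T $$ (i, i))"
    by (simp add: prod_list_diag_prod block_toeplitz_mat_def)
  finally have "det ?T \<noteq> 0 \<longleftrightarrow> (\<forall>i<?N. ?T $$ (i, i) \<noteq> 0)"
    by (auto simp: prod_zero_iff atLeast0LessThan)
  also have "\<dots> \<longleftrightarrow> (\<forall>k<n. \<forall>s<m k. q (istart m k) \<noteq> 0)"
    using pos istart_add_less[of _ n _ m] by (fastforce simp: block_toeplitz_mat_index)
  finally show ?thesis using assms by blast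
qed

lemma sum_lessThan_if_le: "(t::nat) < M \<Longrightarrow> (\<Sum>s<M. if s \<le> t then f s else 0) = (\<Sum>s\<le>t. f s)"
  by (rule sum.mono_neutral_cong_right) auto

lemma sum_row_mult_block_toeplitz:
  assumes i: "i < (\<Sum>k<n. m k)"
    and E: "\<And>k k' s s'. k < n \<Longrightarrow> k' < n \<Longrightarrow> s < m k \<Longrightarrow> s' < m k' \<Longrightarrow>
      E (istart m k + s) (istart m k' + s') = (if k = k' \<and> s \<le> s' then c k (s' - s) else 0)"
  shows "(\<Sum>r<(\<Sum>k<n. m k). q r * E r i) = (block_toeplitz_mat n m q *\<^sub>v block_vec n m c) $ i"
proof -
  obtain k' s' where k': "k' < n" "s' < m k'" and i_eq: "i = istart m k' + s'"
    using block_decomposition_exists[OF i] by blast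
  have "(\<Sum>r<(\<Sum>k<n. m k). q r * E r i) = (\<Sum>k<n. \<Sum>s<m k. q (istart m k + s) * E (istart m k + s) i)"
    by (rule sum_lessThan_blocks)
  also have "\<dots> = (\<Sum>k<n. if k = k' then (\<Sum>s<m k'. if s \<le> s' then q (istart m k' + s) * c k' (s' - s) else 0) else 0)"
    using k' by (intro sum.cong refl) (auto simp: i_eq E intro!: sum.cong)
  also have "\<dots> = (\<Sum>s\<le>s'. q (istart m k' + s) * c k' (s' - s))"
    using k' by (simp add: sum_lessThan_if_le)
  also have "\<dots> = (\<Sum>l\<le>s'. q (istart m k' + (s' - l)) * c k' l)"
    by (rule sum.reindex_bij_witness[of _ "\<lambda>l. s' - l" "\<lambda>l. s' - l"]) auto
  also have "\<dots> = (\<Sum>k<n. if k = k' then (\<Sum>l<m k'. if l \<le> s'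
      then q (istart m k' + (s' - l)) * c k' l else 0) else 0)"
    using k' by (simp add: sum_lessThan_if_le)
  also have "\<dots> = (\<Sum>k<n. \<Sum>l<m k. block_toeplitz_mat n m q $$ (i, istart m k + l)
      * block_vec n m c $ (istart m k + l))"
    using k' by (intro sum.cong refl) (auto simp: i_eq block_toeplitz_mat_index block_vec_index intro!: sum.cong)
  also have "\<dots> = (\<Sum>r<(\<Sum>k<n. m k). block_toeplitz_mat n m q $$ (i, r) * block_vec n m c $ r)"
    by (rule sum_lessThan_blocks[symmetric])
  also have "\<dots> = (block_toeplitz_mat n m q *\<^sub>v block_vec n m c) $ i"
    using i by (simp add: block_toeplitz_mat_def block_vec_def scalar_prod_def atLeast0LessThan)
  finally show ?thesis .
qed

lemma mult_mat_vec_reindex_block_vec: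
  assumes h: "bij_betw h {..<N} (UNIV :: 'n::finite set)" and N: "N = (\<Sum>k<n. m k)"
  shows "mat N N (\<lambda>(r, t). case_prod f (block_pos n m r) (h t)) *\<^sub>v vec N (\<lambda>t. vec_nth v (h t))
    = block_vec n m (\<lambda>k l. \<Sum>a\<in>UNIV. f k l a * vec_nth v a)"
proof (rule eq_vecI)
  fix r assume "r < dim_vec (block_vec n m (\<lambda>k l. \<Sum>a\<in>UNIV. f k l a * vec_nth v a))"
  then have r: "r < N" using N by (simp add: block_vec_def)
  have "(\<Sum>t<N. case_prod f (block_pos n m r) (h t) * vec_nth v (h t))
      = (\<Sum>a\<in>UNIV. case_prod f (block_pos n m r) a * vec_nth v a)"
    by (rule sum.reindex_bij_betw[OF h])
  then show "(mat N N (\<lambda>(r, t). case_prod f (block_pos n m r) (h t)) *\<^sub>v vec N (\<lambda>t. vec_nth v (h t))) $ r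
      = block_vec n m (\<lambda>k l. \<Sum>a\<in>UNIV. f k l a * vec_nth v a) $ r"
    using r N by (simp add: block_vec_def scalar_prod_def atLeast0LessThan split: prod.split)
qed (simp add: N block_vec_def)

lemma det_coordinate_mat_nonzero:
  fixes f :: "nat \<Rightarrow> nat \<Rightarrow> 'n::finite \<Rightarrow> 'a::field"
  assumes h: "bij_betw h {..<N} (UNIV :: 'n set)" and N: "N = (\<Sum>k<n. m k)"
    and inj: "\<And>v. (\<forall>k<n. \<forall>l<m k. (\<Sum>a\<in>UNIV. f k l a * vec_nth v a) = 0) \<Longrightarrow> v = 0"
  shows "det (mat N N (\<lambda>(r, t). case_prod f (block_pos n m r) (h t))) \<noteq> 0"
proof
  let ?C = "mat N N (\<lambda>(r, t). case_prod f (block_pos n m r) (h t))"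
  assume "det ?C = 0"
  then obtain w where w: "w \<in> carrier_vec N" "w \<noteq> 0\<^sub>v N" "?C *\<^sub>v w = 0\<^sub>v N"
    using det_0_iff_vec_prod_zero[of ?C N] by auto
  obtain v where v: "w = vec N (\<lambda>t. vec_nth v (h t))"
    using bij_betw_vec_reindex[OF h] w(1) unfolding bij_betw_def by blast
  have zero: "block_vec n m (\<lambda>k l. \<Sum>a\<in>UNIV. f k l a * vec_nth v a) = 0\<^sub>v N"
    using w(3) mult_mat_vec_reindex_block_vec[OF h N, of f v] v by simp
  have "(\<Sum>a\<in>UNIV. f k l a * vec_nth v a) = 0" if "k < n" "l < m k" for k l
  proof -
    have "istart m k + l < N" using istart_add_less[of k n l m] that N by simp
    then show ?thesis
      using arg_cong[OF zero, of "\<lambda>u. u $ (istart m k + l)"] that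
        block_vec_index[of k n l m "\<lambda>k l. \<Sum>a\<in>UNIV. f k l a * vec_nth v a"]
      by simp
  qed
  then have "v = 0" using inj by blast
  then show False using v w(2) by (auto intro: eq_vecI)
qed

lemma transpose_mult_phi_map:
  assumes P: "P \<in> carrier_mat N N" and Om: "\<And>a. Om a x \<in> carrier_mat N N"
    and B: "\<And>a. B a \<in> carrier_mat N N" and OmP: "\<And>a. Om a x * P = P * B a" and i: "i < N"
  shows "(transpose_mat P *\<^sub>v phi_map N Om x v) $ i
    = (\<Sum>r<N. P $$ (N - 1, r) * (\<Sum>a\<in>UNIV. vec_nth v a * B a $$ (r, i)))"
proof -
  have entry: "(A * A') $$ (N - 1, i) = (\<Sum>j<N. A $$ (N - 1, j) * A' $$ (j, i))"
    if "A \<in> carrier_mat N N" "A' \<in> carrier_mat N N" for A A'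
    using that i by (simp add: scalar_prod_def atLeast0LessThan)
  have "(transpose_mat P *\<^sub>v phi_map N Om x v) $ i
      = (\<Sum>j<N. P $$ (j, i) * (\<Sum>a\<in>UNIV. vec_nth v a * Om a x $$ (N - 1, j)))"
    using P i by (simp add: phi_map_def scalar_prod_def atLeast0LessThan)
  also have "\<dots> = (\<Sum>j<N. \<Sum>a\<in>UNIV. vec_nth v a * (Om a x $$ (N - 1, j) * P $$ (j, i)))"
    by (simp add: sum_distrib_left mult_ac)
  also have "\<dots> = (\<Sum>a\<in>UNIV. vec_nth v a * (\<Sum>j<N. Om a x $$ (N - 1, j) * P $$ (j, i)))"
    by (subst sum.swap) (simp add: sum_distrib_left)
  also have "\<dots> = (\<Sum>a\<in>UNIV. vec_nth v a * (Om a x * P) $$ (N - 1, i))"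
    by (rule sum.cong[OF refl]) (simp only: entry[OF Om P])
  also have "\<dots> = (\<Sum>a\<in>UNIV. vec_nth v a * (\<Sum>r<N. P $$ (N - 1, r) * B a $$ (r, i)))"
    by (rule sum.cong[OF refl]) (simp only: OmP entry[OF P B])
  also have "\<dots> = (\<Sum>a\<in>UNIV. \<Sum>r<N. P $$ (N - 1, r) * (vec_nth v a * B a $$ (r, i)))"
    by (simp add: sum_distrib_left mult_ac)
  also have "\<dots> = (\<Sum>r<N. P $$ (N - 1, r) * (\<Sum>a\<in>UNIV. vec_nth v a * B a $$ (r, i)))"
    by (subst sum.swap) (simp add: sum_distrib_left)
  finally show ?thesis .
qed

lemma transpose_mult_phi_map_eq_block_toeplitz:
  assumes m_sum: "(\<Sum>k<n. m k) = N" and P: "P \<in> carrier_mat N N"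
    and Om: "\<And>a. Om a x \<in> carrier_mat N N"
    and OmP: "\<And>a. Om a x * P = P * (- diag_block_mat (map (\<lambda>k. dZblock m z k a x) [0..<n]))"
  shows "transpose_mat P *\<^sub>v phi_map N Om x v = block_toeplitz_mat n m (\<lambda>r. - P $$ (N - 1, r))
    *\<^sub>v block_vec n m (\<lambda>k l. \<Sum>a\<in>UNIV. cpartial (z k l) a x * vec_nth v a)"
proof (rule eq_vecI)
  define D where "D a = diag_block_mat (map (\<lambda>k. dZblock m z k a x) [0..<n])" for a
  have D: "D a \<in> carrier_mat N N" for a
    using diag_block_dZblock_carrier[of m z a x n] m_sum by (simp add: D_def)
  fix i assume "i < dim_vec (block_toeplitz_mat n m (\<lambda>r. - P $$ (N - 1, r))
    *\<^sub>v block_vec n m (\<lambda>k l. \<Sum>a\<in>UNIV. cpartial (z k l) a x * vec_nth v a))"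
  then have i: "i < N" using m_sum by (simp add: block_toeplitz_mat_def)
  have "(transpose_mat P *\<^sub>v phi_map N Om x v) $ i
      = (\<Sum>r<N. P $$ (N - 1, r) * (\<Sum>a\<in>UNIV. vec_nth v a * (- D a) $$ (r, i)))"
    using transpose_mult_phi_map[of P N Om x "\<lambda>a. - D a" i v] P Om D OmP i by (simp add: D_def)
  also have "\<dots> = (\<Sum>r<N. - P $$ (N - 1, r) * (\<Sum>a\<in>UNIV. vec_nth v a * D a $$ (r, i)))"
  proof -
    have "(- D a) $$ (r, i) = - D a $$ (r, i)" if "r < N" for a r
      using D[of a] i that by simp
    then show ?thesis by (intro sum.cong refl) (simp add: sum_negf)
  qed
  also have "\<dots> = (block_toeplitz_mat n m (\<lambda>r. - P $$ (N - 1, r))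
      *\<^sub>v block_vec n m (\<lambda>k l. \<Sum>a\<in>UNIV. cpartial (z k l) a x * vec_nth v a)) $ i"
    unfolding m_sum[symmetric]
    by (rule sum_row_mult_block_toeplitz)
      (use i m_sum in \<open>auto simp: D_def diag_block_dZblock_index mult.commute if_distrib cong: if_cong\<close>)
  finally show "(transpose_mat P *\<^sub>v phi_map N Om x v) $ i = \<dots>" .
qed (use m_sum P in \<open>simp add: block_toeplitz_mat_def\<close>)

lemma bij_phi_map_iff_last_row_nonzero:
  fixes Om :: "'N::finite \<Rightarrow> complex^'N \<Rightarrow> complex mat"
  assumes N: "N = CARD('N)" and m_sum: "(\<Sum>k<n. m k) = N" and m_pos: "\<forall>k<n. 0 < m k"
    and P: "P \<in> carrier_mat N N" and det_P: "det P \<noteq> 0"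
    and Om: "\<And>a. Om a x \<in> carrier_mat N N"
    and OmP: "\<And>a. Om a x * P = P * (- diag_block_mat (map (\<lambda>k. dZblock m z k a x) [0..<n]))"
    and dz_inj: "\<And>v. (\<forall>k<n. \<forall>l<m k. (\<Sum>a\<in>UNIV. vec_nth v a * cpartial (z k l) a x) = 0) \<Longrightarrow> v = 0"
  shows "bij_betw (phi_map N Om x) UNIV (carrier_vec N) \<longleftrightarrow> (\<forall>k<n. P $$ (N - 1, istart m k) \<noteq> 0)"
proof -
  obtain h where h: "bij_betw h {..<N} (UNIV :: 'N set)"
    using ex_bij_betw_nat_finite[of "UNIV :: 'N set"] N by (auto simp: atLeast0LessThan)
  define u where "u v = vec N (\<lambda>t. vec_nth v (h t))" for v :: "complex^'N"
  define C where "C = mat N N (\<lambda>(r, t). case_prod (\<lambda>k l a. cpartial (z k l) a x) (block_pos n m r) (h t))"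
  define T where "T = block_toeplitz_mat n m (\<lambda>r. - P $$ (N - 1, r))"
  have T: "T \<in> carrier_mat N N" and C: "C \<in> carrier_mat N N"
    using block_toeplitz_mat_carrier[of n m] m_sum by (auto simp: T_def C_def)
  have u: "bij_betw u UNIV (carrier_vec N)"
    unfolding u_def by (rule bij_betw_vec_reindex[OF h])
  have "transpose_mat P *\<^sub>v phi_map N Om x v = T *\<^sub>v (C *\<^sub>v u v)" for v
    using transpose_mult_phi_map_eq_block_toeplitz[where Om = Om and x = x and z = z and v = v, OF m_sum P Om OmP]
      mult_mat_vec_reindex_block_vec[OF h m_sum[symmetric], of "\<lambda>k l a. cpartial (z k l) a x" v]
    by (simp add: T_def C_def u_def)
  then have phi_eq: "(*\<^sub>v) (transpose_mat P) \<circ> phi_map N Om x = (*\<^sub>v) (T * C) \<circ> u"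
    using T C by (auto simp: assoc_mult_mat_vec u_def)
  have det_C: "det C \<noteq> 0"
    unfolding C_def using dz_inj
    by (intro det_coordinate_mat_nonzero[OF h m_sum[symmetric]]) (simp add: mult.commute)
  have "bij_betw (phi_map N Om x) UNIV (carrier_vec N)
      \<longleftrightarrow> bij_betw ((*\<^sub>v) (transpose_mat P) \<circ> phi_map N Om x) UNIV (carrier_vec N)"
    using P det_P det_transpose[OF P]
    by (intro bij_betw_comp_iff2) (auto simp: bij_mult_mat_vec_iff_det phi_map_def)
  also have "\<dots> \<longleftrightarrow> det (T * C) \<noteq> 0"
    unfolding phi_eq using T C by (simp flip: bij_betw_comp_iff[OF u] add: bij_mult_mat_vec_iff_det)
  also have "\<dots> \<longleftrightarrow> det T \<noteq> 0"
    using T C det_C by (simp add: det_mult)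
  also have "\<dots> \<longleftrightarrow> (\<forall>k<n. P $$ (N - 1, istart m k) \<noteq> 0)"
    unfolding T_def det_block_toeplitz_mat_nonzero_iff[OF m_pos] by simp
  finally show ?thesis .
qed

theorem mainTheorem3:
  fixes W :: "(complex^'N::finite) set"
    and T :: "complex^'N \<Rightarrow> complex mat"
    and Om :: "'N \<Rightarrow> complex^'N \<Rightarrow> complex mat"
    and lam :: "nat \<Rightarrow> complex"
    and P :: "complex^'N \<Rightarrow> complex mat"
    and n :: nat and m :: "nat \<Rightarrow> nat"
    and z :: "nat \<Rightarrow> nat \<Rightarrow> complex^'N \<Rightarrow> complex"
  defines "N \<equiv> CARD('N)"
  assumes "open W"
    and okubo: "ext_gen_okubo N W T Om lam"
    and m_pos: "\<forall>k<n. m k \<ge> 1"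
    and m_sum: "(\<Sum>k<n. m k) = N"
    and P_holo: "holomorphic_mat_on N P W"
    and P_inv: "\<forall>x\<in>W. invertible_mat (P x)"
    and PT: "\<forall>x\<in>W. T x * P x = P x * diag_block_mat (map (\<lambda>k. Zblock m z k x) [0..<n])"
    and POm: "\<forall>x\<in>W. \<forall>a. Om a x * P x = P x * (- diag_block_mat (map (\<lambda>k. dZblock m z k a x) [0..<n]))"
    and z_holo: "\<forall>k<n. \<forall>l<m k. holomorphic_on_cn (z k l) W"
    and z_distinct: "\<forall>x\<in>W. \<forall>k<n. \<forall>k'<n. k \<noteq> k' \<longrightarrow> z k 0 x \<noteq> z k' 0 x"
    and z_coord_inj: "\<forall>x\<in>W. \<forall>y\<in>W. (\<forall>k<n. \<forall>l<m k. z k l x = z k l y) \<longrightarrow> x = y"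
    and z_coord_diff: "\<forall>x\<in>W. \<forall>v::complex^'N.
          (\<forall>k<n. \<forall>l<m k. (\<Sum>a\<in>UNIV. vec_nth v a * cpartial (z k l) a x) = 0) \<longrightarrow> v = 0"
  shows "(\<forall>x\<in>W. bij_betw (phi_map N Om x) UNIV (carrier_vec N)) \<longleftrightarrow>
         (\<forall>x\<in>W. \<forall>k<n. P x $$ (N - 1, istart m k) \<noteq> 0)"
proof -
  have "bij_betw (phi_map N Om x) UNIV (carrier_vec N) \<longleftrightarrow> (\<forall>k<n. P x $$ (N - 1, istart m k) \<noteq> 0)"
    if x: "x \<in> W" for x
  proof (rule bij_phi_map_iff_last_row_nonzero)
    show "N = CARD('N)" by (simp add: N_def)
    show "(\<Sum>k<n. m k) = N" "\<forall>k<n. 0 < m k" using m_sum m_pos by auto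
    show "P x \<in> carrier_mat N N" using P_holo x by (simp add: holomorphic_mat_on_def)
    show "det (P x) \<noteq> 0" using P_inv x by (simp add: invertible_mat_det_nonzero)
    show "Om a x \<in> carrier_mat N N" for a
      using okubo x by (simp add: ext_gen_okubo_def holomorphic_mat_on_def Let_def)
  qed (use POm z_coord_diff x in auto)
  then show ?thesis by blast
qed

end
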